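(* Let $I$ be an interval graph, i.e. the graph with two vertices and a single edge joining them. Then there exist a sequence of metrics $g^{(n)}$ on $I$ and a sequence of smooth (positive) density functions $\rho^{(n)}$ on $I$ such that $$\overline{\lambda_1}\left(g^{(n)},\rho^{(n)}\right)\to\infty\quad\text{as }n\to\infty,$$ where $\overline{\lambda_1}(g,\rho):=\lambda_1(g,\rho)\,L(g)\int_{(I,g)}\rho\,dx_g$.
   Context: A metric $g$ on $I$ is a positive number; $(I,g)$ is the interval $[0,\ell]$ with $\ell=\sqrt g$, $L(g)=\ell$, and $dx_g$ is Lebesgue measure on $[0,\ell]$. A density function $\rho$ is a positive function on the edge, smooth up to the endpoints. $0=\lambda_0(g,\rho)<\lambda_1(g,\rho)\le\lambda_2(g,\rho)\le\cdots$ are the eigenvalues (with multiplicity) of $-f''=\lambda\rho f$ on $[0,\ell]$ with the Kirchhoff--Neumann vertex conditions, which on the interval graph are $f'(0)=f'(\ell)=0$. *)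

theory Defs
  imports "HOL-Analysis.Analysis" "HOL-Library.Function_Algebras"
begin

definition edge_length :: "real \<Rightarrow> real" where
  "edge_length g = sqrt g"

definition edge :: "real \<Rightarrow> real set" where
  "edge g = {0..edge_length g}"

text \<open>Smoothness up to the endpoints: \<open>D k\<close> is the \<open>k\<close>-th derivative, one-sided at the
  endpoints.\<close>

definition smooth_on_edge :: "real \<Rightarrow> (real \<Rightarrow> real) \<Rightarrow> bool" where
  "smooth_on_edge g \<rho> \<longleftrightarrow>
     (\<exists>D :: nat \<Rightarrow> real \<Rightarrow> real. (\<forall>x\<in>edge g. D 0 x = \<rho> x) \<and>
        (\<forall>k. \<forall>x\<in>edge g. (D k has_real_derivative D (Suc k) x) (at x within edge g)))"

definition is_density :: "real \<Rightarrow> (real \<Rightarrow> real) \<Rightarrow> bool" where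
  "is_density g \<rho> \<longleftrightarrow> smooth_on_edge g \<rho> \<and> (\<forall>x\<in>edge g. \<rho> x > 0)"

interpretation fun_real: vector_space "\<lambda>(c::real) (f::real \<Rightarrow> real) x. c * f x"
  by unfold_locales (auto simp: algebra_simps fun_eq_iff)

text \<open>Functions on the edge are represented by their extension by zero, so that the
  dimension of the eigenspace is not affected by values outside the edge.\<close>

definition eigenspace :: "real \<Rightarrow> (real \<Rightarrow> real) \<Rightarrow> real \<Rightarrow> (real \<Rightarrow> real) set" where
  "eigenspace g \<rho> \<mu> =
     {f. (\<forall>x. x \<notin> edge g \<longrightarrow> f x = 0) \<and>
         (\<exists>f'. (\<forall>x\<in>edge g. (f has_real_derivative f' x) (at x within edge g)) \<and>
               (\<forall>x\<in>edge g. (f' has_real_derivative - (\<mu> * \<rho> x * f x)) (at x within edge g)) \<and>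
               f' 0 = 0 \<and> f' (edge_length g) = 0)}"

lemma subspace_eigenspace: "fun_real.subspace (eigenspace g \<rho> \<mu>)"
proof (rule fun_real.subspaceI)
  show "0 \<in> eigenspace g \<rho> \<mu>"
    by (auto simp: eigenspace_def zero_fun_def intro!: exI[of _ "\<lambda>_. 0"])
next
  fix f h assume "f \<in> eigenspace g \<rho> \<mu>" "h \<in> eigenspace g \<rho> \<mu>"
  then obtain f' h' where
    "\<forall>x. x \<notin> edge g \<longrightarrow> f x = 0" "\<forall>x. x \<notin> edge g \<longrightarrow> h x = 0"
    "\<forall>x\<in>edge g. (f has_real_derivative f' x) (at x within edge g)"
    "\<forall>x\<in>edge g. (f' has_real_derivative - (\<mu> * \<rho> x * f x)) (at x within edge g)"
    "f' 0 = 0" "f' (edge_length g) = 0"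
    "\<forall>x\<in>edge g. (h has_real_derivative h' x) (at x within edge g)"
    "\<forall>x\<in>edge g. (h' has_real_derivative - (\<mu> * \<rho> x * h x)) (at x within edge g)"
    "h' 0 = 0" "h' (edge_length g) = 0"
    unfolding eigenspace_def by blast
  then show "f + h \<in> eigenspace g \<rho> \<mu>"
    by (auto simp: eigenspace_def plus_fun_def algebra_simps
        intro!: exI[of _ "\<lambda>x. f' x + h' x"] derivative_eq_intros)
next
  fix c f assume "f \<in> eigenspace g \<rho> \<mu>"
  then obtain f' where
    "\<forall>x. x \<notin> edge g \<longrightarrow> f x = 0"
    "\<forall>x\<in>edge g. (f has_real_derivative f' x) (at x within edge g)"
    "\<forall>x\<in>edge g. (f' has_real_derivative - (\<mu> * \<rho> x * f x)) (at x within edge g)"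
    "f' 0 = 0" "f' (edge_length g) = 0"
    unfolding eigenspace_def by blast
  then show "(\<lambda>x. c * f x) \<in> eigenspace g \<rho> \<mu>"
    by (auto simp: eigenspace_def algebra_simps
        intro!: exI[of _ "\<lambda>x. c * f' x"] derivative_eq_intros)
qed

definition is_eigenvalue :: "real \<Rightarrow> (real \<Rightarrow> real) \<Rightarrow> real \<Rightarrow> bool" where
  "is_eigenvalue g \<rho> \<mu> \<longleftrightarrow> (\<exists>f\<in>eigenspace g \<rho> \<mu>. f \<noteq> 0)"

definition multiplicity_of :: "real \<Rightarrow> (real \<Rightarrow> real) \<Rightarrow> real \<Rightarrow> nat" where
  "multiplicity_of g \<rho> \<mu> = fun_real.dim (eigenspace g \<rho> \<mu>)"

text \<open>The number of eigenvalues not exceeding \<open>\<mu>\<close>, counted with multiplicity. The spectrum is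
  discrete and bounded below, so the sum ranges over a finite set.\<close>

definition eigenvalue_count :: "real \<Rightarrow> (real \<Rightarrow> real) \<Rightarrow> real \<Rightarrow> nat" where
  "eigenvalue_count g \<rho> \<mu> = (\<Sum>\<nu> | is_eigenvalue g \<rho> \<nu> \<and> \<nu> \<le> \<mu>. multiplicity_of g \<rho> \<nu>)"

text \<open>The \<open>k\<close>-th term, starting from \<open>k = 0\<close>, of the nondecreasing enumeration of the
  eigenvalues with multiplicity: the first point at which the count exceeds \<open>k\<close>.\<close>

definition eigval :: "nat \<Rightarrow> real \<Rightarrow> (real \<Rightarrow> real) \<Rightarrow> real" where
  "eigval k g \<rho> = (LEAST \<mu>. k < eigenvalue_count g \<rho> \<mu>)"

definition normalized_eigval1 :: "real \<Rightarrow> (real \<Rightarrow> real) \<Rightarrow> real" where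
  "normalized_eigval1 g \<rho> =
     eigval 1 g \<rho> * edge_length g * set_lebesgue_integral lborel (edge g) \<rho>"

end

theory Submission
  imports Defs "HOL-Real_Asymp.Real_Asymp"
begin

text \<open>Fix the density \<open>1 / (1 + x)\<^sup>2\<close> and let the length \<open>\<ell>\<close> tend to infinity: the total mass
  stays bounded below, so it is enough that \<open>\<lambda>\<^sub>1 \<ge> 1/4\<close>. In the variable \<open>s = ln (1 + x)\<close> the
  equation has constant coefficients, and \<open>u = sqrt (1 + x) * f'\<close> solves the Dirichlet problem
  \<open>u'' + (\<lambda> - 1/4) u = 0\<close> on \<open>[0, S]\<close>, \<open>S = ln (1 + \<ell>)\<close>; hence \<open>\<lambda>\<^sub>1 = 1/4 + (\<pi> / S)\<^sup>2\<close>.\<close>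

text \<open>With this density the eigenvalue equation becomes the Euler equation (1 + x)^2 f'' +
  \<lambda> f = 0.\<close>

definition euler_density :: "real \<Rightarrow> real" where
  "euler_density x = 1 / (1 + x)\<^sup>2"

definition euler_eigval :: "real \<Rightarrow> real" where
  "euler_eigval g = 1 / 4 + (pi / ln (1 + edge_length g))\<^sup>2"

section \<open>Calculus with one-sided derivatives on the edge, and a criterion for dimension
  one\<close>

lemma edge_length_pos: "g > 0 \<Longrightarrow> edge_length g > 0"
  by (simp add: edge_length_def)

lemma has_real_derivative_cong_on:
  assumes "x \<in> S" "(f has_real_derivative a) (at x within S)" "\<And>y. y \<in> S \<Longrightarrow> f y = h y"
  shows "(h has_real_derivative a) (at x within S)"
  by (rule has_field_derivative_transform_within[OF assms(2), of 1]) (use assms in auto)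

text \<open>The edge is a nondegenerate interval, so each of its points, endpoints included, is a
  limit point and limits of difference quotients are unique.\<close>

lemma edge_derivative_unique:
  assumes "g > 0" "x \<in> edge g"
    and "(f has_real_derivative a) (at x within edge g)"
    and "(f has_real_derivative b) (at x within edge g)"
  shows "a = b"
proof -
  have "x islimpt edge g"
    using assms(2) edge_length_pos[OF assms(1)] by (simp add: edge_def)
  then have "at x within edge g \<noteq> bot"
    by (simp add: trivial_limit_within)
  then show ?thesis
    using assms(3,4) unfolding has_field_derivative_iff by (rule tendsto_unique)
qed

lemma edge_deriv_zero_constant:
  assumes "\<And>x. x \<in> edge g \<Longrightarrow> (f has_real_derivative 0) (at x within edge g)"
    and "x \<in> edge g" "y \<in> edge g"
  shows "f x = f y"
proof -
  have "convex (edge g)" by (simp add: edge_def)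
  from has_field_derivative_zero_constant[OF this assms(1)] assms(2,3) show ?thesis by auto
qed

text \<open>A nondecreasing function with equal end values is squeezed to a constant, so its
  derivative vanishes at every point. This avoids integrating \<open>J'\<close>.\<close>

lemma edge_deriv_nonneg_equal_ends:
  assumes g: "g > 0"
    and J: "\<And>x. x \<in> edge g \<Longrightarrow> (J has_real_derivative J' x) (at x within edge g)"
    and nonneg: "\<And>x. x \<in> edge g \<Longrightarrow> J' x \<ge> 0"
    and ends: "J 0 = J (edge_length g)"
    and x: "x \<in> edge g"
  shows "J' x = 0"
proof -
  have mono: "J a \<le> J b" if "0 \<le> a" "b \<le> edge_length g" "a \<le> b" for a b
  proof -
    have "(J has_derivative (*) (J' y)) (at y within {a..b})" if "a \<le> y" "y \<le> b" for y
    proof -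
      have "(J has_real_derivative J' y) (at y within {a..b})"
        using J[of y] that \<open>0 \<le> a\<close> \<open>b \<le> edge_length g\<close>
        by (auto intro: DERIV_subset simp: edge_def)
      then show ?thesis by (simp add: has_field_derivative_def)
    qed
    from mvt_very_simple[OF \<open>a \<le> b\<close> this] obtain y where
      "y \<in> {a..b}" "J b - J a = J' y * (b - a)" by auto
    moreover have "J' y \<ge> 0"
      using nonneg[of y] \<open>y \<in> {a..b}\<close> that by (auto simp: edge_def)
    ultimately show ?thesis
      using that by (metis diff_ge_0_iff_ge mult_nonneg_nonneg)
  qed
  have const: "J y = J 0" if "y \<in> edge g" for y
    using mono[of 0 y] mono[of y "edge_length g"] ends that by (auto simp: edge_def)
  have "(J has_real_derivative 0) (at x within edge g)"
    by (rule has_real_derivative_cong_on[OF x DERIV_const]) (simp add: const)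
  from edge_derivative_unique[OF g x J[OF x] this] show ?thesis .
qed

text \<open>Evaluation at \<open>x\<close> is an injective linear functional on \<open>V\<close>, so
  every element is a multiple of \<open>h\<close>.\<close>

lemma dim_eq_1:
  assumes V: "fun_real.subspace V" and h: "h \<in> V" "h \<noteq> 0"
    and inj: "\<And>f. f \<in> V \<Longrightarrow> f x = 0 \<Longrightarrow> f = 0"
  shows "fun_real.dim V = 1"
proof (rule fun_real.dim_unique[of "{h}"])
  have hx: "h x \<noteq> 0" using inj h by blast
  show "V \<subseteq> fun_real.span {h}"
  proof
    fix f assume f: "f \<in> V"
    let ?r = "\<lambda>y. f x / h x * h y"
    have "?r \<in> V" using V h(1) by (rule fun_real.subspace_scale)
    then have "f - ?r \<in> V" by (rule fun_real.subspace_diff[OF V f])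
    then have "f - ?r = 0" by (rule inj) (simp add: hx)
    then have "f = ?r" by simp
    moreover have "?r \<in> fun_real.span {h}"
      by (intro fun_real.span_scale fun_real.span_base) simp
    ultimately show "f \<in> fun_real.span {h}" by simp
  qed
qed (use h in auto)

section \<open>Rigidity of eigenfunctions: below \<open>euler_eigval\<close>, and above 1/4\<close>

lemma eigenspaceE:
  assumes "f \<in> eigenspace g euler_density \<mu>"
  obtains p where
    "\<And>x. x \<notin> edge g \<Longrightarrow> f x = 0"
    "\<And>x. x \<in> edge g \<Longrightarrow> (f has_real_derivative p x) (at x within edge g)"
    "\<And>x. x \<in> edge g \<Longrightarrow> (p has_real_derivative - (\<mu> * f x / (1 + x)\<^sup>2)) (at x within edge g)"
    "p 0 = 0" "p (edge_length g) = 0"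
  using assms unfolding eigenspace_def euler_density_def by auto

text \<open>Picone's identity: \<open>\<psi>\<close> is the logarithmic derivative in \<open>s\<close> of the function
  \<open>cos (\<theta> (s - S / 2))\<close>, which is positive on \<open>[0, S]\<close> since \<open>\<theta> < \<pi> / S\<close>; with \<open>\<theta>\<^sup>2 > \<mu> - 1/4\<close>
  the derivative of \<open>J = u u' - u\<^sup>2 \<psi>\<close> controls \<open>u\<^sup>2\<close>.\<close>

lemma eigenfunction_below_constant:
  assumes g: "g > 0" and f: "f \<in> eigenspace g euler_density \<mu>"
    and \<mu>: "\<mu> < euler_eigval g" and x: "x \<in> edge g"
  shows "f x = f 0" and "\<mu> \<noteq> 0 \<Longrightarrow> f x = 0"
proof -
  obtain p where
    "\<And>x. x \<notin> edge g \<Longrightarrow> f x = 0" and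
    fp: "\<And>x. x \<in> edge g \<Longrightarrow> (f has_real_derivative p x) (at x within edge g)" and
    pf: "\<And>x. x \<in> edge g \<Longrightarrow>
           (p has_real_derivative - (\<mu> * f x / (1 + x)\<^sup>2)) (at x within edge g)" and
    p0: "p 0 = 0" "p (edge_length g) = 0"
    by (rule eigenspaceE[OF f]) blast
  define S where "S = ln (1 + edge_length g)"
  have S: "S > 0" unfolding S_def using edge_length_pos[OF g] by simp
  \<comment> \<open>The maximum with 0 keeps \<open>r\<close>, and hence \<open>\<theta>\<close>,
    positive even when \<open>\<mu>\<close> is at most 1/4.\<close>
  have "max 0 (\<mu> - 1/4) < (pi / S)\<^sup>2"
    using \<mu> S by (auto simp: euler_eigval_def S_def)
  then obtain r where r: "max 0 (\<mu> - 1/4) < r" "r < (pi / S)\<^sup>2" using dense by blast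
  define \<theta> where "\<theta> = sqrt r"
  have \<theta>: "\<theta> > 0" "\<theta>\<^sup>2 > \<mu> - 1/4" using r by (auto simp: \<theta>_def)
  have "\<theta> < sqrt ((pi / S)\<^sup>2)" unfolding \<theta>_def using r(2) by (rule real_sqrt_less_mono)
  then have "\<theta> < pi / S" using S by (simp only: real_sqrt_abs) simp
  then have \<theta>S: "\<theta> * S < pi" using S by (simp add: pos_less_divide_eq)
  define \<psi> where "\<psi> x = - \<theta> * tan (\<theta> * (ln (1 + x) - S / 2))" for x
  \<comment> \<open>This is the Riccati equation d\<psi>/ds = -(\<theta>^2 + \<psi>^2); the
    denominator \<open>1 + x\<close> comes from ds = dx / (1 + x).\<close>
  have \<psi>: "(\<psi> has_real_derivative - (\<theta>\<^sup>2 + (\<psi> x)\<^sup>2) / (1 + x)) (at x within edge g)"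
    if "x \<in> edge g" for x
  proof -
    have x: "0 \<le> x" "x \<le> edge_length g" using that by (auto simp: edge_def)
    have s: "0 \<le> ln (1 + x)" "ln (1 + x) \<le> S" using x by (auto simp: S_def)
    define a where "a = \<theta> * (ln (1 + x) - S / 2)"
    have "\<theta> * (- (S / 2)) \<le> a" "a \<le> \<theta> * (S / 2)"
      unfolding a_def by (rule mult_left_mono; use \<theta> s in simp)+
    \<comment> \<open>Centring at \<open>S / 2\<close> bounds the argument by
      \<open>\<theta> * S / 2\<close> in absolute value, so the tangent has no pole on the
      edge.\<close>
    then have "- (pi / 2) < a" "a < pi / 2" using \<theta>S by auto
    then have c: "cos a > 0" by (rule cos_gt_zero_pi)
    then have sec: "inverse ((cos a)\<^sup>2) = 1 + (tan a)\<^sup>2" by (simp add: tan_sec power_inverse)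
    have "((\<lambda>x. \<theta> * (ln (1 + x) - S / 2)) has_real_derivative \<theta> * (1 / (1 + x))) (at x within edge g)"
      using x by (auto intro!: derivative_eq_intros)
    moreover have "(tan has_real_derivative inverse ((cos a)\<^sup>2)) (at a)"
      using c by (intro DERIV_tan) simp
    ultimately have "((\<lambda>x. tan (\<theta> * (ln (1 + x) - S / 2))) has_real_derivative
        inverse ((cos a)\<^sup>2) * (\<theta> * (1 / (1 + x)))) (at x within edge g)"
      unfolding a_def by (rule DERIV_chain2[rotated])
    then have "(\<psi> has_real_derivative - \<theta> * (inverse ((cos a)\<^sup>2) * (\<theta> * (1 / (1 + x))))) (at x within edge g)"
      unfolding \<psi>_def by (rule DERIV_cmult)
    also have "- \<theta> * (inverse ((cos a)\<^sup>2) * (\<theta> * (1 / (1 + x)))) = - (\<theta>\<^sup>2 + (\<psi> x)\<^sup>2) / (1 + x)"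
    proof -
      have "\<theta>\<^sup>2 + (\<psi> x)\<^sup>2 = \<theta> * \<theta> * (1 + (tan a)\<^sup>2)"
        by (simp add: \<psi>_def a_def[symmetric] power2_eq_square distrib_left mult_ac)
      then show ?thesis by (simp add: sec)
    qed
    finally show ?thesis .
  qed
  \<comment> \<open>For u = sqrt (1 + x) * p and u' = du/ds, the first two terms are u u' and the
    last is u^2 \<psi>.\<close>
  define J where "J x = (1 + x) * (p x)\<^sup>2 / 2 - \<mu> * f x * p x - (1 + x) * (p x)\<^sup>2 * \<psi> x" for x
  \<comment> \<open>This is ((u' - u \<psi>)^2 + (\<theta>^2 + 1/4 - \<mu>) u^2) / (1 + x), the
    derivative in x rather than in s.\<close>
  define J' where "J' x = (p x * (1/2 - \<psi> x) - \<mu> * f x / (1 + x))\<^sup>2 + (\<theta>\<^sup>2 + 1/4 - \<mu>) * (p x)\<^sup>2" for x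
  have J: "(J has_real_derivative J' x) (at x within edge g)" if "x \<in> edge g" for x
  proof -
    have x: "1 + x > 0" using that by (auto simp: edge_def)
    define t where "t = 1 + x"
    have t: "t > 0" using x by (simp add: t_def)
    show ?thesis
      unfolding J_def
      apply (rule DERIV_cong)
       apply (rule fp[OF that] pf[OF that] \<psi>[OF that] derivative_intros | (use x in simp; fail))+
      unfolding J'_def t_def[symmetric] using t
      by (simp_all add: field_simps power2_eq_square)
  qed
  have coeff: "\<theta>\<^sup>2 + 1/4 - \<mu> > 0" using \<theta> by simp
  have pz: "p x = 0" if "x \<in> edge g" for x
  proof -
    have "J' x = 0"
    proof (rule edge_deriv_nonneg_equal_ends[OF g J _ _ that])
      \<comment> \<open>Every term of \<open>J\<close> has a factor \<open>p\<close>, which vanishes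
        at both ends by the Neumann conditions.\<close>
      show "J 0 = J (edge_length g)" by (simp add: J_def p0)
      show "J' y \<ge> 0" for y unfolding J'_def using coeff by simp
    qed
    then have "(\<theta>\<^sup>2 + 1/4 - \<mu>) * (p x)\<^sup>2 \<le> 0"
      unfolding J'_def by (smt (verit) zero_le_power2)
    then show ?thesis using coeff by (simp add: mult_le_0_iff)
  qed
  have "0 \<in> edge g" using edge_length_pos[OF g] by (simp add: edge_def)
  then show "f x = f 0"
    using fp pz x by (intro edge_deriv_zero_constant[of g f]) fastforce+
  assume "\<mu> \<noteq> 0"
  \<comment> \<open>Since \<open>p\<close> vanishes identically, so does its derivative, which the
    equation expresses as a nonzero multiple of \<open>f x\<close>.\<close>
  have "(p has_real_derivative 0) (at x within edge g)"
    by (rule has_real_derivative_cong_on[OF x DERIV_const]) (simp add: pz)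
  from edge_derivative_unique[OF g x pf[OF x] this] \<open>\<mu> \<noteq> 0\<close> x show "f x = 0"
    by (auto simp: edge_def)
qed

text \<open>The quadratic form \<open>H\<close> is a first integral, positive definite for \<open>\<mu> > 1/4\<close>.\<close>

lemma eigenfunction_eq_0:
  assumes g: "g > 0" and f: "f \<in> eigenspace g euler_density \<mu>"
    and \<mu>: "\<mu> > 1/4" and f0: "f 0 = 0"
  shows "f = 0"
proof
  fix x
  obtain p where
    out: "\<And>x. x \<notin> edge g \<Longrightarrow> f x = 0" and
    fp: "\<And>x. x \<in> edge g \<Longrightarrow> (f has_real_derivative p x) (at x within edge g)" and
    pf: "\<And>x. x \<in> edge g \<Longrightarrow>
           (p has_real_derivative - (\<mu> * f x / (1 + x)\<^sup>2)) (at x within edge g)" and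
    p0: "p 0 = 0" "p (edge_length g) = 0"
    by (rule eigenspaceE[OF f]) blast
  define H where "H x = (1 + x) * (p x)\<^sup>2 - f x * p x + \<mu> * (f x)\<^sup>2 / (1 + x)" for x
  show "f x = 0 x"
  proof (cases "x \<in> edge g")
    case True
    have "(H has_real_derivative 0) (at y within edge g)" if "y \<in> edge g" for y
    proof -
      have y: "1 + y > 0" using that by (auto simp: edge_def)
      define t where "t = 1 + y"
      have t: "t > 0" using y by (simp add: t_def)
      show ?thesis
        unfolding H_def
        apply (rule DERIV_cong)
         apply (rule fp[OF that] pf[OF that] derivative_intros | (use y in simp; fail))+
        unfolding t_def[symmetric] using t
        by (simp_all add: field_simps power2_eq_square)
    qed
    moreover have "0 \<in> edge g" using edge_length_pos[OF g] by (simp add: edge_def)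
    ultimately have "H x = H 0" using True by (intro edge_deriv_zero_constant[of g H]) auto
    then have H0: "H x = 0" by (simp add: H_def f0 p0)
    define t where "t = 1 + x"
    have "t > 0" using True by (auto simp: edge_def t_def)
    \<comment> \<open>Completing the square in \<open>t * p x\<close> exhibits the definiteness of
      \<open>H\<close> for \<open>\<mu>\<close> above 1/4.\<close>
    then have "t * H x = (t * p x - f x / 2)\<^sup>2 + (\<mu> - 1/4) * (f x)\<^sup>2"
      unfolding H_def t_def[symmetric] by (simp add: field_simps power2_eq_square)
    moreover have "t * H x = 0" by (simp add: H0)
    ultimately have "(\<mu> - 1/4) * (f x)\<^sup>2 \<le> 0"
      using zero_le_power2[of "t * p x - f x / 2"] by linarith
    then show ?thesis using \<mu> by (simp add: mult_le_0_iff)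
  qed (simp add: out)
qed

section \<open>The two lowest eigenvalues and their multiplicities\<close>

lemma eigenspace_0: "indicator (edge g) \<in> eigenspace g \<rho> 0"
proof -
  \<comment> \<open>The indicator is the constant 1 extended by zero, as the encoding of
    \<open>eigenspace\<close> requires.\<close>
  have "(indicator (edge g) has_real_derivative 0) (at x within edge g)" if "x \<in> edge g" for x
    by (rule has_real_derivative_cong_on[OF that DERIV_const[of "1::real"]]) simp
  then show ?thesis
    unfolding eigenspace_def by (auto intro!: exI[of _ "\<lambda>_. 0"])
qed

lemma indicator_edge_nonzero:
  assumes "g > 0"
  shows "indicator (edge g) \<noteq> (0 :: real \<Rightarrow> real)"
proof -
  have "indicator (edge g) 0 \<noteq> (0::real)"
    using edge_length_pos[OF assms] by (simp add: edge_def)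
  then show ?thesis by auto
qed

text \<open>The eigenfunction comes from the first Dirichlet mode u = \<mu> sin (\<omega> s):
  dividing by sqrt (1 + x) gives \<open>p\<close>, and solving p' = -\<mu> h / (1 + x)^2 for h gives
  \<open>h\<close>.\<close>

lemma eigenspace_euler_eigval:
  assumes g: "g > 0"
  obtains f where "f \<in> eigenspace g euler_density (euler_eigval g)" "f \<noteq> 0"
proof -
  define S where "S = ln (1 + edge_length g)"
  have S: "S > 0" unfolding S_def using edge_length_pos[OF g] by simp
  define \<omega> where "\<omega> = pi / S"
  define \<mu> where "\<mu> = euler_eigval g"
  have \<mu>: "\<mu> = 1/4 + \<omega>\<^sup>2" by (simp add: \<mu>_def \<omega>_def S_def euler_eigval_def)
  define h where "h x = sqrt (1 + x) * (sin (\<omega> * ln (1 + x)) / 2 - \<omega> * cos (\<omega> * ln (1 + x)))" for x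
  define p where "p x = \<mu> * sin (\<omega> * ln (1 + x)) / sqrt (1 + x)" for x
  define f where "f x = (if x \<in> edge g then h x else 0)" for x
  have 0: "0 \<in> edge g" using edge_length_pos[OF g] by (simp add: edge_def)
  have hp: "(h has_real_derivative p x) (at x within edge g)"
   and ph: "(p has_real_derivative - (\<mu> * euler_density x * h x)) (at x within edge g)"
    if "x \<in> edge g" for x
  proof -
    have x: "1 + x > 0" using that by (auto simp: edge_def)
    \<comment> \<open>Writing \<open>1 + x\<close> as a square makes both derivative identities
      rational in \<open>q\<close>; the first also uses \<mu> = 1/4 + \<omega>^2.\<close>
    define q where "q = sqrt (1 + x)"
    have q: "q > 0" "1 + x = q\<^sup>2" using x by (auto simp: q_def)
    define s where "s = ln (1 + x)"
    have sqrt': "((\<lambda>x. sqrt (1 + x)) has_real_derivative 1 / (2 * q)) (at x within edge g)"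
      unfolding q_def using x by (auto intro!: derivative_eq_intros simp: field_simps)
    have ln': "((\<lambda>x. ln (1 + x)) has_real_derivative 1 / q\<^sup>2) (at x within edge g)"
      unfolding q(2)[symmetric] using x by (auto intro!: derivative_eq_intros)
    show "(h has_real_derivative p x) (at x within edge g)"
      unfolding h_def p_def
      apply (rule DERIV_cong)
       apply (rule sqrt' ln' derivative_intros | (use x in simp; fail))+
      unfolding s_def[symmetric] q_def[symmetric] \<mu> using q(1)
      by (simp_all add: field_simps power2_eq_square)
    show "(p has_real_derivative - (\<mu> * euler_density x * h x)) (at x within edge g)"
      unfolding h_def p_def euler_density_def
      apply (rule DERIV_cong)
       apply (rule sqrt' ln' derivative_intros | (use x in simp; fail))+
      unfolding s_def[symmetric] q_def[symmetric] unfolding q(2) using q(1)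
      by (simp_all add: field_simps power2_eq_square)
  qed
  have "(f has_real_derivative p x) (at x within edge g)" if "x \<in> edge g" for x
    by (rule has_real_derivative_cong_on[OF that hp[OF that]]) (simp add: f_def)
  moreover have "p 0 = 0" by (simp add: p_def)
  moreover have "p (edge_length g) = 0"
    using S by (simp add: p_def \<omega>_def S_def[symmetric])
  ultimately have "f \<in> eigenspace g euler_density \<mu>"
    unfolding eigenspace_def using ph by (auto simp: f_def intro!: exI[of _ p])
  \<comment> \<open>At 0 the logarithm vanishes, leaving the value -\<omega>.\<close>
  moreover have "f 0 \<noteq> 0" using 0 S by (simp add: f_def h_def \<omega>_def)
  then have "f \<noteq> 0" by auto
  ultimately show ?thesis using that by (simp add: \<mu>_def)
qed

text \<open>As 0 lies below \<open>euler_eigval g\<close>, eigenfunctions for 0 are constant on the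
  edge and determined by their value at 0.\<close>

lemma multiplicity_of_0:
  assumes g: "g > 0"
  shows "multiplicity_of g euler_density 0 = 1"
  unfolding multiplicity_of_def
proof (rule dim_eq_1[OF subspace_eigenspace eigenspace_0, of _ _ 0])
  have S: "ln (1 + edge_length g) > 0" using edge_length_pos[OF g] by simp
  show "indicator (edge g) \<noteq> (0 :: real \<Rightarrow> real)" using g by (rule indicator_edge_nonzero)
  have "0 < euler_eigval g" using S by (simp add: euler_eigval_def add_pos_nonneg)
  fix f assume f: "f \<in> eigenspace g euler_density 0" and "f 0 = 0"
  then have "f x = 0" for x
    using eigenfunction_below_constant(1)[OF g f \<open>0 < euler_eigval g\<close>]
    by (cases "x \<in> edge g") (auto simp: eigenspace_def)
  then show "f = 0" by auto
qed

lemma is_eigenvalue_below: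
  assumes "g > 0" "is_eigenvalue g euler_density \<mu>" "\<mu> < euler_eigval g"
  shows "\<mu> = 0"
proof (rule ccontr)
  assume "\<mu> \<noteq> 0"
  obtain f where f: "f \<in> eigenspace g euler_density \<mu>" "f \<noteq> 0"
    using assms(2) by (auto simp: is_eigenvalue_def)
  have "f x = 0" for x
    using eigenfunction_below_constant(2)[OF assms(1) f(1) assms(3) _ \<open>\<mu> \<noteq> 0\<close>] f(1)
    by (cases "x \<in> edge g") (auto simp: eigenspace_def)
  then show False using f(2) by auto
qed

text \<open>Both 0 and \<open>euler_eigval g\<close> are simple and no other eigenvalue lies below
  the latter, so the count first exceeds 1 there.\<close>

lemma eigval_1_euler_density:
  assumes g: "g > 0"
  shows "eigval 1 g euler_density = euler_eigval g"
  unfolding eigval_def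
proof (rule Least_equality)
  let ?\<mu> = "euler_eigval g"
  have "ln (1 + edge_length g) > 0" using edge_length_pos[OF g] by simp
  then have \<mu>: "?\<mu> > 1/4" by (simp add: euler_eigval_def)
  have ev0: "is_eigenvalue g euler_density 0"
    unfolding is_eigenvalue_def using eigenspace_0 indicator_edge_nonzero[OF g] by blast
  obtain f where f: "f \<in> eigenspace g euler_density ?\<mu>" "f \<noteq> 0"
    using eigenspace_euler_eigval[OF g] .
  have mult: "multiplicity_of g euler_density ?\<mu> = 1"
    unfolding multiplicity_of_def
    by (rule dim_eq_1[OF subspace_eigenspace f]) (rule eigenfunction_eq_0[OF g _ \<mu>])
  have "{\<nu>. is_eigenvalue g euler_density \<nu> \<and> \<nu> \<le> ?\<mu>} = {0, ?\<mu>}"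
    using is_eigenvalue_below[OF g] f ev0 \<mu> by (force simp: is_eigenvalue_def)
  then show "1 < eigenvalue_count g euler_density ?\<mu>"
    using \<mu> by (simp add: eigenvalue_count_def mult multiplicity_of_0[OF g])
  fix y assume y: "1 < eigenvalue_count g euler_density y"
  show "?\<mu> \<le> y"
  proof (rule ccontr)
    assume "\<not> ?\<mu> \<le> y"
    \<comment> \<open>Below \<open>euler_eigval g\<close> at most the simple eigenvalue 0 is
      counted, so the count is at most 1.\<close>
    then have "{\<nu>. is_eigenvalue g euler_density \<nu> \<and> \<nu> \<le> y} \<subseteq> {0}"
      using is_eigenvalue_below[OF g] by force
    then have "eigenvalue_count g euler_density y \<le> (\<Sum>\<nu>\<in>{0}. multiplicity_of g euler_density \<nu>)"
      unfolding eigenvalue_count_def by (intro sum_mono2) auto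
    then show False using y by (simp add: multiplicity_of_0[OF g])
  qed
qed

section \<open>Smoothness and mass of the density, and the limit\<close>

lemma is_density_euler_density: "is_density g euler_density"
proof -
  \<comment> \<open>Closed form of the k-th derivative of (1 + x)^(-2).\<close>
  define D where "D k x = (- 1) ^ k * fact (Suc k) / (1 + x) ^ (k + 2)" for k and x :: real
  have "(D k has_real_derivative D (Suc k) x) (at x within edge g)" if "x \<in> edge g" for k x
  proof -
    have x: "1 + x > 0" using that by (auto simp: edge_def)
    define t where "t = 1 + x"
    have t: "t > 0" using x by (simp add: t_def)
    show ?thesis
      unfolding D_def
      apply (rule DERIV_cong)
       apply (rule derivative_intros)+
      unfolding t_def[symmetric] using t
      by (simp_all add: field_simps)
  qed
  moreover have "D 0 x = euler_density x" for x by (simp add: D_def euler_density_def power2_eq_square)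
  ultimately have "smooth_on_edge g euler_density"
    unfolding smooth_on_edge_def by blast
  then show ?thesis
    by (simp add: is_density_def euler_density_def edge_def)
qed

lemma integral_euler_density:
  assumes "g > 0"
  shows "set_lebesgue_integral lborel (edge g) euler_density = 1 - 1 / (1 + edge_length g)"
proof -
  let ?l = "edge_length g"
  have "(\<integral>x. euler_density x * indicator {0..?l} x \<partial>lborel) = - 1 / (1 + ?l) - (- 1 / (1 + 0))"
  proof (rule integral_FTC_Icc_real)
    show "0 \<le> ?l" using edge_length_pos[OF assms] by simp
    fix x :: real assume "0 \<le> x"
    then show "((\<lambda>x. - 1 / (1 + x)) has_real_derivative euler_density x) (at x)"
      unfolding euler_density_def
      by (auto intro!: derivative_eq_intros simp: power2_eq_square)
    show "isCont euler_density x"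
      unfolding euler_density_def using \<open>0 \<le> x\<close> by (auto intro!: continuous_intros)
  qed
  then show ?thesis by (simp add: set_lebesgue_integral_def edge_def mult.commute)
qed

theorem theorem5p11:
  shows "\<exists>(g :: nat \<Rightarrow> real) (\<rho> :: nat \<Rightarrow> real \<Rightarrow> real).
           (\<forall>n. g n > 0) \<and> (\<forall>n. is_density (g n) (\<rho> n)) \<and>
           filterlim (\<lambda>n. normalized_eigval1 (g n) (\<rho> n)) at_top sequentially"
proof (intro exI conjI allI)
  \<comment> \<open>The edge has length \<open>Suc n\<close>, hence at least 1 already for
    \<open>n = 0\<close>, so the mass 1 - 1 / (1 + length) is at least 1/2.\<close>
  define g :: "nat \<Rightarrow> real" where "g n = (real (Suc n))\<^sup>2" for n
  show g: "g n > 0" for n by (simp add: g_def)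
  show "is_density (g n) ((\<lambda>_. euler_density) n)" for n by (rule is_density_euler_density)
  have lower: "real n / 8 \<le> normalized_eigval1 (g n) euler_density" for n
  proof -
    have l: "edge_length (g n) = real (Suc n)"
      unfolding edge_length_def g_def by (rule real_sqrt_unique[OF refl]) simp
    \<comment> \<open>The factors bound, in order, the eigenvalue, the length and the mass from
      below.\<close>
    have "real n / 8 \<le> 1/4 * real (Suc n) * (1/2)" by simp
    also have "\<dots> \<le> euler_eigval (g n) * real (Suc n) * (1 - 1 / (1 + real (Suc n)))"
      by (intro mult_mono) (auto simp: euler_eigval_def field_simps)
    finally show ?thesis
      unfolding normalized_eigval1_def eigval_1_euler_density[OF g] integral_euler_density[OF g] l .
  qed
  have "filterlim (\<lambda>n. real n / 8) at_top sequentially"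
    by real_asymp
  then show "filterlim (\<lambda>n. normalized_eigval1 (g n) ((\<lambda>_. euler_density) n)) at_top sequentially"
    by (rule filterlim_at_top_mono) (intro always_eventually allI lower)
qed

end
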